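(* For every integer $m\ge 2$ and every $\delta\in[0,1]$, $$\Gamma_m(\delta)\le H_m(\delta)\le u_m(\delta),$$ where $\Gamma_m(\delta)=\max\left\{\delta,\frac{1}{m-(m-1)\delta}\right\}$ and $u_m(\delta)=\delta+\frac{1-\delta}{m}$. In particular, $H_m(0)=1/m$, and for fixed $\delta$, $H_m(\delta)\to\delta$ as $m\to\infty$.
   Context: Instance: firms $F=\{1,\dots,m\}$, workers $W=\{1,\dots,n\}$ ($n$ arbitrary), values $A=(a_{ij})$ with $a_{ij}\ge 0$, additive: $V_i(T)=\sum_{j\in T}a_{ij}$. A complete matching $X=(X_1,\dots,X_m)$ is a partition of $W$ (parts may be empty). $M_j=\max_i a_{ij}$. If some $a_{ij}>0$, $\delta(A)=\min_{a_{ij}>0}a_{ij}/M_j$; for the all-zero market $\delta(A)=1$. $X$ is EF1 if for every pair of firms $i,k$ with $X_k\neq\varnothing$ there is $g\in X_k$ with $V_i(X_i)\ge V_i(X_k\setminus\{g\})$. Core: profits $x_i\ge 0$ and wages $y_j\ge 0$ satisfy local financing if $x_i+\sum_{j\in X_i}y_j=V_i(X_i)$ for all $i$. $(X,x,y)$ is in the $\alpha$-core if $\sum_{i\in I}x_i+\sum_{j\in T}y_j\ge\alpha\sum_{j\in T}\max_{i\in I}a_{ij}$ for all nonempty $I\subseteq F$ and all $T\subseteq W$. $\alpha(X)$ is the largest $\alpha$ (supremum in $[0,+\infty]$) for which some nonnegative $x,y$ satisfying local financing make $(X,x,y)$ an element of the $\alpha$-core. Frontier: $H_m(\delta)=\inf\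 \max_{X\text{ EF1}}\alpha(X)$, where the infimum is over all instances $A$ with $m$ firms and $\delta(A)\ge\delta$, and the maximum is over all EF1 complete matchings $X$ of the instance. *)

theory Defs
  imports "HOL-Analysis.Analysis"
begin

text \<open>
  A market with \<open>m\<close> firms \<open>{1..m}\<close> and \<open>n\<close> workers \<open>{1..n}\<close> is given by \<open>m\<close>, \<open>n\<close> and a function
  \<open>a\<close>; only the values \<open>a i j\<close> with \<open>i \<in> {1..m}\<close> and \<open>j \<in> {1..n}\<close> matter. The same holds for
  matchings, profits and wages.
\<close>

definition market :: "nat \<Rightarrow> nat \<Rightarrow> (nat \<Rightarrow> nat \<Rightarrow> real) \<Rightarrow> bool" where
  "market m n a \<longleftrightarrow> (\<forall>i\<in>{1..m}. \<forall>j\<in>{1..n}. 0 \<le> a i j)"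

definition firm_value :: "(nat \<Rightarrow> nat \<Rightarrow> real) \<Rightarrow> nat \<Rightarrow> nat set \<Rightarrow> real" where
  "firm_value a i T = (\<Sum>j\<in>T. a i j)"

definition max_value :: "nat \<Rightarrow> (nat \<Rightarrow> nat \<Rightarrow> real) \<Rightarrow> nat \<Rightarrow> real" where
  "max_value m a j = Max ((\<lambda>i. a i j) ` {1..m})"

definition market_delta :: "nat \<Rightarrow> nat \<Rightarrow> (nat \<Rightarrow> nat \<Rightarrow> real) \<Rightarrow> real" where
  "market_delta m n a =
     (if \<exists>i\<in>{1..m}. \<exists>j\<in>{1..n}. 0 < a i j
      then Min {a i j / max_value m a j | i j. i \<in> {1..m} \<and> j \<in> {1..n} \<and> 0 < a i j}
      else 1)"

definition complete_matching :: "nat \<Rightarrow> nat \<Rightarrow> (nat \<Rightarrow> nat set) \<Rightarrow> bool" where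
  "complete_matching m n X \<longleftrightarrow>
     disjoint_family_on X {1..m} \<and> (\<Union>i\<in>{1..m}. X i) = {1..n}"

definition EF1 :: "nat \<Rightarrow> (nat \<Rightarrow> nat \<Rightarrow> real) \<Rightarrow> (nat \<Rightarrow> nat set) \<Rightarrow> bool" where
  "EF1 m a X \<longleftrightarrow>
     (\<forall>i\<in>{1..m}. \<forall>k\<in>{1..m}. X k \<noteq> {} \<longrightarrow>
        (\<exists>g\<in>X k. firm_value a i (X i) \<ge> firm_value a i (X k - {g})))"

definition local_financing ::
    "nat \<Rightarrow> (nat \<Rightarrow> nat \<Rightarrow> real) \<Rightarrow> (nat \<Rightarrow> nat set) \<Rightarrow> (nat \<Rightarrow> real) \<Rightarrow> (nat \<Rightarrow> real) \<Rightarrow> bool" where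
  "local_financing m a X x y \<longleftrightarrow>
     (\<forall>i\<in>{1..m}. x i + (\<Sum>j\<in>X i. y j) = firm_value a i (X i))"

text \<open>The matching enters the core condition only through local financing.\<close>

definition core_ineqs ::
    "nat \<Rightarrow> nat \<Rightarrow> (nat \<Rightarrow> nat \<Rightarrow> real) \<Rightarrow> real \<Rightarrow> (nat \<Rightarrow> real) \<Rightarrow> (nat \<Rightarrow> real) \<Rightarrow> bool" where
  "core_ineqs m n a \<alpha> x y \<longleftrightarrow>
     (\<forall>I T. I \<noteq> {} \<and> I \<subseteq> {1..m} \<and> T \<subseteq> {1..n} \<longrightarrow>
        (\<Sum>i\<in>I. x i) + (\<Sum>j\<in>T. y j) \<ge> \<alpha> * (\<Sum>j\<in>T. Max ((\<lambda>i. a i j) ` I)))"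

definition in_core ::
    "nat \<Rightarrow> nat \<Rightarrow> (nat \<Rightarrow> nat \<Rightarrow> real) \<Rightarrow> real \<Rightarrow>
     (nat \<Rightarrow> nat set) \<Rightarrow> (nat \<Rightarrow> real) \<Rightarrow> (nat \<Rightarrow> real) \<Rightarrow> bool" where
  "in_core m n a \<alpha> X x y \<longleftrightarrow>
     (\<forall>i\<in>{1..m}. 0 \<le> x i) \<and> (\<forall>j\<in>{1..n}. 0 \<le> y j) \<and>
     local_financing m a X x y \<and> core_ineqs m n a \<alpha> x y"

definition core_alpha ::
    "nat \<Rightarrow> nat \<Rightarrow> (nat \<Rightarrow> nat \<Rightarrow> real) \<Rightarrow> (nat \<Rightarrow> nat set) \<Rightarrow> ereal" where
  "core_alpha m n a X = Sup {ereal \<alpha> | \<alpha>. 0 \<le> \<alpha> \<and> (\<exists>x y. in_core m n a \<alpha> X x y)}"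

text \<open>
  The inner supremum is a maximum: it ranges over finitely many values, as shown below. In
  \<^typ>\<open>ereal\<close> the supremum of the empty set is \<open>- \<infinity>\<close>, so a market without any EF1 complete
  matching could not satisfy a nonnegative lower bound vacuously.
\<close>

definition EF1_frontier :: "nat \<Rightarrow> real \<Rightarrow> ereal" where
  "EF1_frontier m \<delta> =
     (INF (n, a)\<in>{(n, a). market m n a \<and> \<delta> \<le> market_delta m n a}.
        SUP X\<in>{X. complete_matching m n X \<and> EF1 m a X}. core_alpha m n a X)"

lemma finite_core_alpha_values:
  "finite (core_alpha m n a ` {X. complete_matching m n X \<and> EF1 m a X})"
proof (rule finite_subset)
  show "core_alpha m n a ` {X. complete_matching m n X \<and> EF1 m a X}
        \<subseteq> core_alpha m n a ` ({1..m} \<rightarrow>\<^sub>E Pow {1..n})"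
  proof (rule image_subsetI)
    fix X assume "X \<in> {X. complete_matching m n X \<and> EF1 m a X}"
    then have "restrict X {1..m} \<in> {1..m} \<rightarrow>\<^sub>E Pow {1..n}"
      by (auto simp: complete_matching_def)
    moreover have "core_alpha m n a X = core_alpha m n a (restrict X {1..m})"
      by (simp add: core_alpha_def in_core_def local_financing_def)
    ultimately show "core_alpha m n a X \<in> core_alpha m n a ` ({1..m} \<rightarrow>\<^sub>E Pow {1..n})"
      by blast
  qed
  show "finite (core_alpha m n a ` ({1..m} \<rightarrow>\<^sub>E Pow {1..n}))"
    by (intro finite_imageI finite_PiE) auto
qed

definition frontier_lower :: "nat \<Rightarrow> real \<Rightarrow> real" where
  "frontier_lower m \<delta> = max \<delta> (1 / (real m - (real m - 1) * \<delta>))"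

definition frontier_upper :: "nat \<Rightarrow> real \<Rightarrow> real" where
  "frontier_upper m \<delta> = \<delta> + (1 - \<delta>) / real m"

end

theory Submission imports Defs "HOL-Combinatorics.Permutations"
begin

text \<open>
  Lower bound. Assign the workers in rounds: in each round take a maximum weight matching of the
  firms to the remaining workers, keep its pairs of positive value, and iterate. A firm values what it
  receives in a round at least as much as any worker left over, so the union of the rounds is EF1. It
  is also nonwasteful, so paying every worker the full value created gives \<open>\<alpha> \<ge> \<delta>\<close>. For the other
  term of \<open>\<Gamma>\<close>, pay in every round a dual solution \<open>(p, q)\<close> of the matching problem, shifted such that
  some firm \<open>k\<close> has \<open>p k = 0\<close>. A firm \<open>i\<close> and a set \<open>K\<close> of workers of that round then satisfy
  \<open>a i K \<le> |K| p i + q K\<close>, which suffices unless \<open>|K| = m\<close>; in that case the worker matched with \<open>k\<close>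
  is worth at most \<open>1 / \<delta>\<close> times his wage to \<open>i\<close>, which closes the gap.

  Upper bound. In the market with \<open>m\<close> workers, each worth 1 to the first firm and \<open>\<epsilon>\<close> to the others,
  EF1 gives the first firm at most one worker, and the grand coalition bounds \<open>\<alpha>\<close>.
\<close>

section \<open>Dual solutions of the assignment problem\<close>

text \<open>The endpoints \<open>x\<close> and \<open>z\<close> are kept apart from the list of
  interior vertices, so \<open>[]\<close> stands for a single arc and closed walks are the case
  \<open>z = x\<close>.\<close>

fun path_weight :: "('a \<Rightarrow> 'a \<Rightarrow> real) \<Rightarrow> 'a \<Rightarrow> 'a list \<Rightarrow> 'a \<Rightarrow> real" where
  "path_weight w x [] z = w x z"
| "path_weight w x (y # ys) z = w x y + path_weight w y ys z"

lemma path_weight_append: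
  "path_weight w x (ys @ y # zs) z = path_weight w x ys y + path_weight w y zs z"
  by (induction w x ys y rule: path_weight.induct) auto

text \<open>The endpoint \<open>z\<close> is kept free for the induction; for \<open>z = x\<close> the left-hand side is the weight of
  the cyclic permutation \<open>\<sigma>\<close>.\<close>

lemma path_weight_permutation:
  assumes "distinct (x # ys)"
  shows "\<exists>\<sigma>. \<sigma> permutes set (x # ys) \<and>
    (\<forall>z. (\<Sum>i\<in>set (x # ys). w i (if \<sigma> i = x then z else \<sigma> i)) = path_weight w x ys z)"
  using assms
proof (induction ys arbitrary: x)
  case Nil
  show ?case by (intro exI[of _ id]) (auto simp: permutes_id)
next
  case (Cons y ys)
  then obtain \<sigma> where \<sigma>: "\<sigma> permutes set (y # ys)"
    and s: "\<And>z. (\<Sum>i\<in>set (y # ys). w i (if \<sigma> i = y then z else \<sigma> i)) = path_weight w y ys z"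
    by (metis distinct.simps(2))
  \<comment> \<open>This inserts \<open>x\<close> into the cycle in front of \<open>y\<close>:
    \<open>x\<close> now goes to \<open>y\<close>, and the arc that returned to \<open>y\<close>
    returns to \<open>x\<close> instead.\<close>
  let ?\<tau> = "Transposition.transpose x y \<circ> \<sigma>"
  have x: "x \<notin> set (y # ys)" using Cons.prems by auto
  have \<tau>: "?\<tau> permutes set (x # y # ys)"
  proof (rule permutes_compose)
    show "\<sigma> permutes set (x # y # ys)" by (rule permutes_subset[OF \<sigma>]) auto
    show "Transposition.transpose x y permutes set (x # y # ys)" by (rule permutes_swap_id) auto
  qed
  have \<tau>x: "?\<tau> x = y" using permutes_not_in[OF \<sigma> x] by simp
  have "(\<Sum>i\<in>set (x # y # ys). w i (if ?\<tau> i = x then z else ?\<tau> i)) = path_weight w x (y # ys) z" for z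
  proof -
    have "(\<Sum>i\<in>set (y # ys). w i (if ?\<tau> i = x then z else ?\<tau> i))
        = (\<Sum>i\<in>set (y # ys). w i (if \<sigma> i = y then z else \<sigma> i))"
    proof (rule sum.cong[OF refl])
      fix i assume "i \<in> set (y # ys)"
      then have "\<sigma> i \<in> set (y # ys)" by (rule permutes_in_image[OF \<sigma>, THEN iffD2])
      with x have "\<sigma> i \<noteq> x" by metis
      then show "w i (if ?\<tau> i = x then z else ?\<tau> i) = w i (if \<sigma> i = y then z else \<sigma> i)"
        using x by (auto simp: Transposition.transpose_def)
    qed
    moreover have "set (x # y # ys) = insert x (set (y # ys))" by simp
    moreover have "y \<noteq> x" using x by auto
    ultimately show ?thesis using x \<tau>x s by simp
  qed
  then show ?case using \<tau> by blast
qed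

text \<open>A repeated vertex splits a closed walk into two shorter closed walks. Without repetition
  the walk is a cycle; as a permutation, extended by the identity at no weight because of
  \<open>diag\<close>, it falls under \<open>perm\<close>.\<close>

lemma closed_path_weight_nonpos:
  assumes N: "finite N" and diag: "\<And>i. i \<in> N \<Longrightarrow> w i i = 0"
    and perm: "\<And>\<sigma>. \<sigma> permutes N \<Longrightarrow> (\<Sum>i\<in>N. w i (\<sigma> i)) \<le> (0::real)"
    and "set (x # ys) \<subseteq> N"
  shows "path_weight w x ys x \<le> 0"
  using \<open>set (x # ys) \<subseteq> N\<close>
proof (induction "length ys" arbitrary: x ys rule: less_induct)
  case less
  consider "distinct (x # ys)" | "x \<in> set ys" | "\<not> distinct ys" by auto
  then show ?case
  proof cases
    case 1
    then obtain \<sigma> where \<sigma>: "\<sigma> permutes set (x # ys)"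
      and s: "(\<Sum>i\<in>set (x # ys). w i (if \<sigma> i = x then x else \<sigma> i)) = path_weight w x ys x"
      using path_weight_permutation[of x ys w] by blast
    have "(\<Sum>i\<in>set (x # ys). w i (if \<sigma> i = x then x else \<sigma> i)) = (\<Sum>i\<in>set (x # ys). w i (\<sigma> i))"
      by (intro sum.cong) auto
    also have "\<dots> = (\<Sum>i\<in>N. w i (\<sigma> i))"
      using less.prems N by (intro sum.mono_neutral_left) (auto simp: permutes_not_in[OF \<sigma>] diag)
    also have "\<dots> \<le> 0" by (rule perm[OF permutes_subset[OF \<sigma> less.prems]])
    finally show ?thesis using s by simp
  next
    case 2
    then obtain as bs where ys: "ys = as @ x # bs" by (meson split_list)
    then show ?thesis
      using less.hyps[of as x] less.hyps[of bs x] less.prems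
      by (auto simp: path_weight_append)
  next
    case 3
    then obtain as y bs cs where ys: "ys = as @ y # bs @ y # cs"
      using not_distinct_decomp by (metis append_Cons append_Nil)
    then show ?thesis
      using less.hyps[of "as @ y # cs" x] less.hyps[of bs y] less.prems
      by (auto simp: path_weight_append)
  qed
qed

text \<open>The potential of \<open>i\<close> is the largest weight of a path from \<open>i\<close> to a fixed base point.\<close>

lemma assignment_potential:
  fixes c :: "'a \<Rightarrow> 'a \<Rightarrow> real"
  assumes N: "finite N"
    and perm: "\<And>\<sigma>. \<sigma> permutes N \<Longrightarrow> (\<Sum>i\<in>N. c i (\<sigma> i)) \<le> (\<Sum>i\<in>N. c i i)"
  shows "\<exists>u. \<forall>i\<in>N. \<forall>k\<in>N. c i k - c k k \<le> u i - u k"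
proof (cases "N = {}")
  case False
  then obtain z where z: "z \<in> N" by blast
  \<comment> \<open>Subtracting \<open>c k k\<close> at the target makes the diagonal vanish and
    shifts all permutation sums by the same constant, so optimality of the identity means that they
    are nonpositive.\<close>
  define w where "w i k = c i k - c k k" for i k
  define P where "P i = (\<lambda>ys. path_weight w i ys z) ` {ys. set ys \<subseteq> N}" for i
  define u where "u i = Sup (P i)" for i
  have permw: "(\<Sum>i\<in>N. w i (\<sigma> i)) \<le> 0" if "\<sigma> permutes N" for \<sigma>
    using perm[OF that] sum.permute[OF that, of "\<lambda>k. c k k"]
    by (simp add: w_def sum_subtractf comp_def)
  have closed: "path_weight w x ys x \<le> 0" if "set (x # ys) \<subseteq> N" for x ys
    using that by (intro closed_path_weight_nonpos[OF N _ permw]) (auto simp: w_def)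
  \<comment> \<open>Every walk from \<open>i\<close> to \<open>z\<close> is closed by the arc from
    \<open>z\<close> to \<open>i\<close>, which caps its weight.\<close>
  have bdd: "bdd_above (P i)" if "i \<in> N" for i
  proof (rule bdd_aboveI)
    fix v assume "v \<in> P i"
    then obtain ys where "v = path_weight w i ys z" "set ys \<subseteq> N" by (auto simp: P_def)
    then show "v \<le> - w z i"
      using closed[of i "ys @ [z]"] that z by (simp add: path_weight_append)
  qed
  have "w i k \<le> u i - u k" if i: "i \<in> N" and k: "k \<in> N" for i k
  proof -
    \<comment> \<open>Any walk from \<open>k\<close> to \<open>z\<close>, preceded by the arc from
      \<open>i\<close> to \<open>k\<close>, competes in the supremum \<open>u i\<close>.\<close>
    have "u k \<le> u i - w i k"
      unfolding u_def[of k]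
    proof (rule cSup_least)
      show "P k \<noteq> {}" by (auto simp: P_def intro: exI[of _ "[]"])
      fix v assume "v \<in> P k"
      then obtain ys where v: "v = path_weight w k ys z" "set ys \<subseteq> N" by (auto simp: P_def)
      then have "path_weight w i (k # ys) z \<in> P i" using k unfolding P_def by (intro imageI) simp
      then have "path_weight w i (k # ys) z \<le> u i" unfolding u_def by (rule cSup_upper[OF _ bdd[OF i]])
      then show "v \<le> u i - w i k" using v by simp
    qed
    then show ?thesis by simp
  qed
  then show ?thesis unfolding w_def by blast
qed auto

text \<open>Linear programming duality when the identity is an optimal assignment. \<open>p\<close>
  is the potential shifted to minimum 0 and \<open>q\<close> is what remains of the diagonal; the
  dual inequality at the minimiser \<open>k0\<close>, where \<open>p\<close> vanishes, makes
  \<open>q\<close> nonnegative.\<close>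

lemma assignment_dual:
  fixes c :: "'a \<Rightarrow> 'a \<Rightarrow> real"
  assumes N: "finite N" "N \<noteq> {}"
    and nonneg: "\<And>i k. i \<in> N \<Longrightarrow> k \<in> N \<Longrightarrow> 0 \<le> c i k"
    and perm: "\<And>\<sigma>. \<sigma> permutes N \<Longrightarrow> (\<Sum>i\<in>N. c i (\<sigma> i)) \<le> (\<Sum>i\<in>N. c i i)"
  obtains p q k0 where "\<forall>i\<in>N. 0 \<le> p i" "\<forall>i\<in>N. 0 \<le> q i" "\<forall>i\<in>N. p i + q i = c i i"
    "\<forall>i\<in>N. \<forall>k\<in>N. c i k \<le> p i + q k" "k0 \<in> N" "p k0 = 0"
proof -
  obtain u where u: "\<And>i k. i \<in> N \<Longrightarrow> k \<in> N \<Longrightarrow> c i k - c k k \<le> u i - u k"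
    using assignment_potential[where c = c, OF N(1) perm] by blast
  have "Min (u ` N) \<in> u ` N" using N by (intro Min_in) auto
  then obtain k0 where k0: "k0 \<in> N" "u k0 = Min (u ` N)" by auto
  have le: "u k0 \<le> u i" if "i \<in> N" for i using that N by (simp add: k0(2))
  define p where "p i = u i - u k0" for i
  define q where "q i = c i i - p i" for i
  have dual: "c i k \<le> p i + q k" if "i \<in> N" "k \<in> N" for i k
    using u[OF that] by (simp add: p_def q_def)
  have "0 \<le> q i" if "i \<in> N" for i
    using dual[OF k0(1) that] nonneg[OF k0(1) that] by (simp add: p_def)
  then show thesis
    using that[of p q k0] dual le k0(1) by (simp add: p_def q_def)
qed

text \<open>Workers of a round are indexed by their partners: \<open>c i k\<close> is the value to
  firm \<open>i\<close> of the worker matched with firm \<open>k\<close>, so the matching is the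
  identity. The dual solution serves as profits and wages.\<close>

lemma round_payoffs:
  fixes c :: "'a \<Rightarrow> 'a \<Rightarrow> real"
  assumes N: "finite N" "N \<noteq> {}"
    and nonneg: "\<And>i k. i \<in> N \<Longrightarrow> k \<in> N \<Longrightarrow> 0 \<le> c i k"
    and perm: "\<And>\<sigma>. \<sigma> permutes N \<Longrightarrow> (\<Sum>i\<in>N. c i (\<sigma> i)) \<le> (\<Sum>i\<in>N. c i i)"
    and \<delta>: "0 \<le> \<delta>" "\<delta> \<le> 1" "(real (card N) - 1) * \<delta> \<le> 1"
    and ratio: "\<And>i k. i \<in> N \<Longrightarrow> k \<in> N \<Longrightarrow> \<delta> * c i k \<le> c k k"
  shows "\<exists>p q. (\<forall>i\<in>N. 0 \<le> p i) \<and> (\<forall>i\<in>N. 0 \<le> q i) \<and> (\<forall>i\<in>N. p i + q i = c i i) \<and>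
    (\<forall>i\<in>N. \<forall>K\<subseteq>N. (\<Sum>k\<in>K. c i k) \<le> (real (card N) - (real (card N) - 1) * \<delta>) * (p i + (\<Sum>k\<in>K. q k)))"
proof -
  obtain p q k0 where "\<forall>i\<in>N. 0 \<le> p i" "\<forall>i\<in>N. 0 \<le> q i" "\<forall>i\<in>N. p i + q i = c i i"
    "\<forall>i\<in>N. \<forall>k\<in>N. c i k \<le> p i + q k" and k0: "k0 \<in> N" "p k0 = 0"
    by (rule assignment_dual[where c = c, OF N nonneg perm])
  note p = this(1)[rule_format] and q = this(2)[rule_format] and pq = this(3)[rule_format]
    and dual = this(4)[rule_format]
  define m where "m = real (card N)"
  define D where "D = m - (m - 1) * \<delta>"
  have m1: "1 \<le> m" using N by (simp add: m_def Suc_leI card_gt_0_iff)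
  have D1: "1 \<le> D"
  proof -
    have "D - 1 = (m - 1) * (1 - \<delta>)" by (simp add: D_def algebra_simps)
    also have "\<dots> \<ge> 0" using m1 \<delta> by simp
    finally show ?thesis by simp
  qed
  have "(\<Sum>k\<in>K. c i k) \<le> D * (p i + (\<Sum>k\<in>K. q k))" if i: "i \<in> N" and K: "K \<subseteq> N" for i K
  proof -
    have q_sum: "0 \<le> sum q K'" if "K' \<subseteq> N" for K' using that q by (intro sum_nonneg) auto
    have sum_le: "(\<Sum>k\<in>K'. c i k) \<le> real (card K') * p i + sum q K'" if "K' \<subseteq> N" for K'
    proof -
      have "(\<Sum>k\<in>K'. c i k) \<le> (\<Sum>k\<in>K'. p i + q k)" using that dual i by (intro sum_mono) auto
      then show ?thesis by (simp add: sum.distrib)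
    qed
    show ?thesis
    proof (cases "K = N")
      case False
      then have "card K < card N" using K N by (simp add: psubset_card_mono psubset_eq)
      then have "real (card K) \<le> m - 1" by (simp add: m_def)
      \<comment> \<open>\<open>D \<ge> m - 1\<close> is exactly the hypothesis
        \<open>(real (card N) - 1) * \<delta> \<le> 1\<close>.\<close>
      also have "\<dots> \<le> D" using \<delta> by (simp add: D_def m_def)
      finally have "real (card K) * p i \<le> D * p i" using p[OF i] by (rule mult_right_mono)
      moreover have "1 * sum q K \<le> D * sum q K" using D1 q_sum[OF K] by (rule mult_right_mono)
      ultimately show ?thesis using sum_le[OF K] by (simp add: distrib_left)
    next
      case True
      \<comment> \<open>\<open>s\<close> is the excess of the value to \<open>i\<close> of the
        worker of \<open>k0\<close> over his wage. Since \<open>p k0 = 0\<close>, that wage is his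
        full value \<open>c k0 k0\<close>, so \<open>ratio\<close> bounds \<open>s\<close> a second
        time.\<close>
      define s where "s = c i k0 - q k0"
      have s1: "s \<le> p i" using dual[OF i k0(1)] by (simp add: s_def)
      have s2: "\<delta> * s \<le> (1 - \<delta>) * q k0"
        using ratio[OF i k0(1)] pq[OF k0(1)] k0(2) by (simp add: s_def algebra_simps)
      have Q: "sum q N = q k0 + sum q (N - {k0})" by (rule sum.remove[OF N(1) k0(1)])
      have "(\<Sum>k\<in>N. c i k) = c i k0 + (\<Sum>k\<in>N - {k0}. c i k)" by (rule sum.remove[OF N(1) k0(1)])
      moreover have "real (card (N - {k0})) = m - 1"
        using N k0(1) m1 by (simp add: m_def card_Diff_singleton of_nat_diff Suc_leI card_gt_0_iff)
      ultimately have *: "(\<Sum>k\<in>N. c i k) \<le> s + (m - 1) * p i + sum q N"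
        using sum_le[of "N - {k0}"] Q by (simp add: s_def)
      \<comment> \<open>Write \<open>s\<close> as
        \<open>(1 - (m - 1) * \<delta>) * s + (m - 1) * (\<delta> * s)\<close>, and bound the first
        part through \<open>s1\<close> and the second through \<open>s2\<close>. The coefficients of
        \<open>p i\<close> and of \<open>sum q N\<close> both become \<open>D\<close>, as
        \<open>D = 1 + (m - 1) * (1 - \<delta>)\<close>.\<close>
      have "(1 - (m - 1) * \<delta>) * s \<le> (1 - (m - 1) * \<delta>) * p i"
        using s1 \<delta>(3) by (intro mult_left_mono) (auto simp: m_def)
      moreover have "(m - 1) * (\<delta> * s) \<le> (m - 1) * ((1 - \<delta>) * q k0)"
        using s2 m1 by (intro mult_left_mono) auto
      moreover have "(m - 1) * (1 - \<delta>) * q k0 \<le> (m - 1) * (1 - \<delta>) * sum q N"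
        using Q q_sum[of "N - {k0}"] m1 \<delta> by (intro mult_left_mono) auto
      ultimately have "s + (m - 1) * p i + sum q N \<le> D * (p i + sum q N)"
        by (simp add: D_def algebra_simps)
      then show ?thesis using * True by simp
    qed
  qed
  then show ?thesis
    using p q pq by (intro exI[of _ p] exI[of _ q]) (auto simp: D_def m_def)
qed

section \<open>Round-based EF1 matchings\<close>

text \<open>The function \<open>\<mu>\<close> may take values outside \<open>R\<close>, which count as no assignment.\<close>

lemma max_matching:
  fixes a :: "nat \<Rightarrow> nat \<Rightarrow> real"
  assumes F: "finite F" and R: "finite R" and nonneg: "\<And>i j. i \<in> F \<Longrightarrow> j \<in> R \<Longrightarrow> 0 \<le> a i j"
  defines "b \<equiv> \<lambda>i j. if j \<in> R then a i j else 0"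
  obtains \<mu> where "inj_on \<mu> F"
    "\<And>\<sigma>. \<sigma> permutes F \<Longrightarrow> (\<Sum>i\<in>F. b i (\<mu> (\<sigma> i))) \<le> (\<Sum>i\<in>F. b i (\<mu> i))"
    "\<And>i g. i \<in> F \<Longrightarrow> g \<in> R \<Longrightarrow> \<forall>k\<in>F. \<mu> k = g \<longrightarrow> b k g = 0 \<Longrightarrow> b i g \<le> b i (\<mu> i)"
proof -
  \<comment> \<open>Adding the indices of the firms supplies dummy partners, so that injections of
    \<open>F\<close> exist even when \<open>R\<close> has fewer elements than
    \<open>F\<close>.\<close>
  define U where "U = R \<union> F"
  define Ms where "Ms = {\<mu> \<in> F \<rightarrow>\<^sub>E U. inj_on \<mu> F}"
  define wt where "wt \<mu> = (\<Sum>i\<in>F. b i (\<mu> i))" for \<mu>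
  have "finite Ms" unfolding Ms_def
    by (rule finite_subset[of _ "F \<rightarrow>\<^sub>E U"]) (use F R in \<open>auto simp: U_def intro: finite_PiE\<close>)
  moreover have "restrict id F \<in> Ms" by (auto simp: Ms_def U_def inj_on_def)
  ultimately have "Max (wt ` Ms) \<in> wt ` Ms" and ge: "\<And>\<nu>. \<nu> \<in> Ms \<Longrightarrow> wt \<nu> \<le> Max (wt ` Ms)"
    by (auto intro!: Max_in)
  then obtain \<mu> where \<mu>: "\<mu> \<in> Ms" and max: "\<And>\<nu>. \<nu> \<in> Ms \<Longrightarrow> wt \<nu> \<le> wt \<mu>" by auto
  have max': "wt \<nu> \<le> wt \<mu>" if "inj_on \<nu> F" "\<nu> ` F \<subseteq> U" for \<nu>
  proof -
    have "restrict \<nu> F \<in> Ms" using that by (auto simp: Ms_def inj_on_def)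
    then have "wt (restrict \<nu> F) \<le> wt \<mu>" by (rule max)
    then show ?thesis by (simp add: wt_def)
  qed
  have inj: "inj_on \<mu> F" and im: "\<mu> ` F \<subseteq> U" using \<mu> by (auto simp: Ms_def)
  have perm: "(\<Sum>i\<in>F. b i (\<mu> (\<sigma> i))) \<le> (\<Sum>i\<in>F. b i (\<mu> i))" if \<sigma>: "\<sigma> permutes F" for \<sigma>
  proof -
    have "inj_on (\<mu> \<circ> \<sigma>) F" "(\<mu> \<circ> \<sigma>) ` F = \<mu> ` F"
      using inj permutes_image[OF \<sigma>] permutes_inj_on[OF \<sigma>, of F]
      by (auto simp only: image_comp[symmetric] intro!: comp_inj_on)
    then have "wt (\<mu> \<circ> \<sigma>) \<le> wt \<mu>" using im by (intro max') auto
    then show ?thesis by (simp add: wt_def)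
  qed
  have swap: "b i g \<le> b i (\<mu> i)"
    if i: "i \<in> F" and g: "g \<in> R" and z: "\<forall>k\<in>F. \<mu> k = g \<longrightarrow> b k g = 0" for i g
  proof (cases "g \<in> \<mu> ` F")
    case False
    let ?\<nu> = "\<mu>(i := g)"
    have "wt ?\<nu> \<le> wt \<mu>"
      using False inj im i g by (intro max') (auto simp: inj_on_def U_def)
    moreover have "wt ?\<nu> = b i g + (\<Sum>k\<in>F - {i}. b k (\<mu> k))"
      unfolding wt_def by (subst sum.remove[OF F i]) auto
    moreover have "wt \<mu> = b i (\<mu> i) + (\<Sum>k\<in>F - {i}. b k (\<mu> k))"
      unfolding wt_def by (rule sum.remove[OF F i])
    ultimately show ?thesis by simp
  next
    case True
    then obtain k where k: "k \<in> F" "\<mu> k = g" by auto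
    show ?thesis
    proof (cases "k = i")
      case True
      then show ?thesis using k by simp
    next
      case False
      let ?S = "F - {i} - {k}"
      have split: "(\<Sum>l\<in>F. f l) = f i + (f k + (\<Sum>l\<in>?S. f l))" for f :: "nat \<Rightarrow> real"
        using F i k False by (simp add: sum.remove[of F i] sum.remove[of "F - {i}" k])
      \<comment> \<open>Firm \<open>k\<close> holds \<open>g\<close> at value 0, so trading partners
        with \<open>i\<close> costs \<open>k\<close> nothing, and optimality prevents
        \<open>i\<close> from gaining.\<close>
      have "(\<Sum>l\<in>F. b l (\<mu> (Transposition.transpose i k l))) \<le> (\<Sum>l\<in>F. b l (\<mu> l))"
        using i k by (intro perm permutes_swap_id) auto
      moreover have "(\<Sum>l\<in>?S. b l (\<mu> (Transposition.transpose i k l))) = (\<Sum>l\<in>?S. b l (\<mu> l))"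
        by (intro sum.cong) (auto simp: Transposition.transpose_def)
      ultimately have "b i g + b k (\<mu> i) \<le> b i (\<mu> i) + b k g"
        using k by (simp add: split)
      moreover have "0 \<le> b k (\<mu> i)" using nonneg k by (simp add: b_def)
      moreover have "b k g = 0" using z k by simp
      ultimately show ?thesis by simp
    qed
  qed
  show thesis using that inj perm swap by blast
qed

text \<open>\<open>\<delta>\<close> controls only ratios of positive values. This condition excludes
  workers placed at value 0 while some firm values them.\<close>

definition nonwasteful :: "nat \<Rightarrow> (nat \<Rightarrow> nat \<Rightarrow> real) \<Rightarrow> (nat \<Rightarrow> nat set) \<Rightarrow> bool" where
  "nonwasteful m a X \<longleftrightarrow> (\<forall>i\<in>{1..m}. \<forall>j\<in>X i. 0 < a i j \<or> (\<forall>k\<in>{1..m}. a k j = 0))"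

text \<open>The induction peels off the first round: it supplies a matching and payoffs for the
  workers left over, to which the pairs, profits and wages of this round are added. Both sides of
  the firmwise inequality are additive over rounds.\<close>

lemma round_matching:
  fixes a :: "nat \<Rightarrow> nat \<Rightarrow> real"
  assumes m: "1 \<le> m" and "finite R"
    and "\<forall>i\<in>{1..m}. \<forall>j\<in>R. 0 \<le> a i j"
    and \<delta>: "0 \<le> \<delta>" "\<delta> \<le> 1" "(real m - 1) * \<delta> \<le> 1"
    and "\<forall>i\<in>{1..m}. \<forall>k\<in>{1..m}. \<forall>j\<in>R. 0 < a i j \<longrightarrow> \<delta> * a k j \<le> a i j"
  shows "\<exists>X x y. disjoint_family_on X {1..m} \<and> (\<Union>i\<in>{1..m}. X i) = R \<and> EF1 m a X \<and> nonwasteful m a X \<and>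
    (\<forall>i\<in>{1..m}. 0 \<le> x i) \<and> (\<forall>j\<in>R. 0 \<le> y j) \<and> local_financing m a X x y \<and>
    (\<forall>i\<in>{1..m}. \<forall>T\<subseteq>R. firm_value a i T \<le> (real m - (real m - 1) * \<delta>) * (x i + (\<Sum>j\<in>T. y j)))"
  using assms(2,3,7)
proof (induction "card R" arbitrary: R rule: less_induct)
  case less
  note R = less.prems(1) and nonneg = less.prems(2)[rule_format] and ratio = less.prems(3)[rule_format]
  let ?F = "{1..m}" and ?D = "real m - (real m - 1) * \<delta>"
  show ?case
  proof (cases "\<exists>i\<in>?F. \<exists>j\<in>R. 0 < a i j")
    case False
    then have zero: "a i j = 0" if "i \<in> ?F" "j \<in> R" for i j
      using nonneg[OF that] that by force
    let ?X = "\<lambda>i. if i = 1 then R else {}"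
    have fv: "firm_value a i T = 0" if "i \<in> ?F" "T \<subseteq> R" for i T
      unfolding firm_value_def using that zero by (intro sum.neutral) auto
    show ?thesis
    proof (intro exI[of _ ?X] exI[of _ "\<lambda>_. 0"] conjI)
      show "EF1 m a ?X" unfolding EF1_def by (auto simp: fv)
      show "local_financing m a ?X (\<lambda>_. 0) (\<lambda>_. 0)" unfolding local_financing_def by (auto simp: fv)
    qed (use m zero fv in \<open>auto simp: disjoint_family_on_def nonwasteful_def\<close>)
  next
    case True
    define b where "b = (\<lambda>i j. if j \<in> R then a i j else 0)"
    obtain \<mu> where inj: "inj_on \<mu> ?F"
      and perm: "\<And>\<sigma>. \<sigma> permutes ?F \<Longrightarrow> (\<Sum>i\<in>?F. b i (\<mu> (\<sigma> i))) \<le> (\<Sum>i\<in>?F. b i (\<mu> i))"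
      and swap: "\<And>i g. i \<in> ?F \<Longrightarrow> g \<in> R \<Longrightarrow> \<forall>k\<in>?F. \<mu> k = g \<longrightarrow> b k g = 0 \<Longrightarrow> b i g \<le> b i (\<mu> i)"
      using max_matching[of ?F R a] R nonneg unfolding b_def by blast
    \<comment> \<open>Pairs of value 0 are dissolved and their workers return to the pool
      \<open>R'\<close>.\<close>
    define S where "S = {i\<in>?F. 0 < b i (\<mu> i)}"
    define R' where "R' = R - \<mu> ` S"
    have b0: "0 \<le> b i j" if "i \<in> ?F" for i j using nonneg that by (simp add: b_def)
    have S: "S \<subseteq> ?F" "finite S" by (auto simp: S_def)
    have SR: "\<mu> ` S \<subseteq> R" by (auto simp: S_def b_def split: if_splits)
    have Spos: "0 < a i (\<mu> i)" if "i \<in> S" for i using that by (auto simp: S_def b_def split: if_splits)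
    have injS: "inj_on \<mu> S" by (rule inj_on_subset[OF inj S(1)])
    have bR: "b i j = a i j" if "j \<in> R" for i j using that by (simp add: b_def)
    have not_S: "b i (\<mu> i) = 0" if "i \<in> ?F" "i \<notin> S" for i using that b0[of i "\<mu> i"] by (auto simp: S_def)
    \<comment> \<open>A worker left over is either unassigned or held at value 0, which is the
      situation covered by \<open>swap\<close>.\<close>
    have best: "a i g \<le> b i (\<mu> i)" if i: "i \<in> ?F" and g: "g \<in> R'" for i g
    proof -
      have "b i g \<le> b i (\<mu> i)"
      proof (rule swap[OF i])
        show "g \<in> R" using g by (simp add: R'_def)
        show "\<forall>k\<in>?F. \<mu> k = g \<longrightarrow> b k g = 0" using g not_S unfolding R'_def by blast
      qed
      then show ?thesis using g by (simp add: R'_def bR)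
    qed
    \<comment> \<open>Progress of the rounds: if no pair were kept, a worker of positive value would
      contradict \<open>best\<close>.\<close>
    have "S \<noteq> {}"
    proof
      assume "S = {}"
      with True obtain i j where "i \<in> ?F" "j \<in> R'" "0 < a i j" by (auto simp: R'_def)
      with best[of i j] not_S[of i] \<open>S = {}\<close> show False by auto
    qed
    then have "R' \<subset> R" using SR by (auto simp: R'_def)
    then have cardR': "card R' < card R" by (rule psubset_card_mono[OF R])
    have R'R: "R' \<subseteq> R" "finite R'" using R by (auto simp: R'_def)
    have nonneg': "\<forall>i\<in>?F. \<forall>j\<in>R'. 0 \<le> a i j" using less.prems(2) R'R(1) by blast
    have ratio': "\<forall>i\<in>?F. \<forall>k\<in>?F. \<forall>j\<in>R'. 0 < a i j \<longrightarrow> \<delta> * a k j \<le> a i j"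
      using less.prems(3) R'R(1) by blast
    obtain X x y where X: "disjoint_family_on X ?F" "(\<Union>i\<in>?F. X i) = R'" and ef: "EF1 m a X"
      and nw: "nonwasteful m a X" and xs: "\<forall>i\<in>?F. 0 \<le> x i" and ys: "\<forall>j\<in>R'. 0 \<le> y j"
      and lf: "local_financing m a X x y"
      and cores: "\<forall>i\<in>?F. \<forall>T\<subseteq>R'. firm_value a i T \<le> ?D * (x i + (\<Sum>j\<in>T. y j))"
      using less.hyps[OF cardR' R'R(2) nonneg' ratio'] by (elim exE conjE) (rule that)
    note x = xs[rule_format] and y = ys[rule_format] and core = cores[rule_format]
    \<comment> \<open>Firms without a kept pair get a worthless dummy worker. This lowers
      permutation sums but not the diagonal, so the identity stays optimal.\<close>
    define c where "c i k = (if k \<in> S then b i (\<mu> k) else 0)" for i k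
    have cdiag: "c k k = b k (\<mu> k)" if "k \<in> ?F" for k using that not_S by (simp add: c_def)
    have "\<exists>p q. (\<forall>i\<in>?F. 0 \<le> p i) \<and> (\<forall>i\<in>?F. 0 \<le> q i) \<and> (\<forall>i\<in>?F. p i + q i = c i i) \<and>
      (\<forall>i\<in>?F. \<forall>K\<subseteq>?F. (\<Sum>k\<in>K. c i k) \<le> (real (card ?F) - (real (card ?F) - 1) * \<delta>) * (p i + (\<Sum>k\<in>K. q k)))"
    proof (rule round_payoffs)
      show "0 \<le> c i k" if "i \<in> ?F" for i k using b0[OF that] by (simp add: c_def)
      show "(\<Sum>i\<in>?F. c i (\<sigma> i)) \<le> (\<Sum>i\<in>?F. c i i)" if "\<sigma> permutes ?F" for \<sigma>
      proof -
        have "(\<Sum>i\<in>?F. c i (\<sigma> i)) \<le> (\<Sum>i\<in>?F. b i (\<mu> (\<sigma> i)))"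
          using b0 by (intro sum_mono) (auto simp: c_def)
        also have "\<dots> \<le> (\<Sum>i\<in>?F. b i (\<mu> i))" by (rule perm[OF that])
        finally show ?thesis using cdiag by simp
      qed
      show "\<delta> * c i k \<le> c k k" if i: "i \<in> ?F" and k: "k \<in> ?F" for i k
      proof (cases "k \<in> S")
        case True
        then have "\<mu> k \<in> R" "0 < b k (\<mu> k)" using SR by (auto simp: S_def)
        then show ?thesis using ratio[OF k i] True by (simp add: c_def bR)
      qed (simp add: c_def)
    qed (use m \<delta> in auto)
    then obtain p q where ps: "\<forall>i\<in>?F. 0 \<le> p i" and qs: "\<forall>i\<in>?F. 0 \<le> q i"
      and pqs: "\<forall>i\<in>?F. p i + q i = c i i"
      and rounds: "\<forall>i\<in>?F. \<forall>K\<subseteq>?F. (\<Sum>k\<in>K. c i k) \<le> ?D * (p i + (\<Sum>k\<in>K. q k))"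
      unfolding card_atLeastAtMost diff_Suc_1 by (elim exE conjE) (rule that)
    note p = ps[rule_format] and q = qs[rule_format] and pq = pqs[rule_format]
      and round = rounds[rule_format]
    define X' where "X' i = (if i \<in> S then insert (\<mu> i) (X i) else X i)" for i
    define x' where "x' i = x i + p i" for i
    define y' where "y' j = (if j \<in> R' then y j else q (inv_into S \<mu> j))" for j
    have XR: "X i \<subseteq> R'" "finite (X i)" if "i \<in> ?F" for i
    proof -
      show "X i \<subseteq> R'" using X(2) that by blast
      then show "finite (X i)" using R'R(2) by (rule finite_subset)
    qed
    have \<mu>X: "\<mu> k \<notin> X i" if "k \<in> S" "i \<in> ?F" for i k using XR(1)[OF that(2)] that(1) by (auto simp: R'_def)
    have y'\<mu>: "y' (\<mu> k) = q k" if "k \<in> S" for k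
      using that injS by (auto simp: y'_def R'_def)
    have y'R: "(\<Sum>j\<in>T. y' j) = (\<Sum>j\<in>T. y j)" if "T \<subseteq> R'" for T
      using that by (intro sum.cong) (auto simp: y'_def)
    have fv: "firm_value a i (X' k) = firm_value a i (X k) + (if k \<in> S then a i (\<mu> k) else 0)"
      if "k \<in> ?F" for i k
      using \<mu>X[of k k] XR(2)[OF that] that by (simp add: X'_def firm_value_def)
    have fv_own: "firm_value a i (X' i) = firm_value a i (X i) + b i (\<mu> i)" if "i \<in> ?F" for i
      using fv[OF that, of i] not_S[OF that] SR by (auto simp: bR)
    show ?thesis
    proof (rule exI[of _ X'], rule exI[of _ x'], rule exI[of _ y'], intro conjI)
      show "disjoint_family_on X' ?F"
        unfolding disjoint_family_on_def
      proof (intro ballI impI)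
        fix i k assume ik: "i \<in> ?F" "k \<in> ?F" "i \<noteq> k"
        then have "X i \<inter> X k = {}" using X(1) by (auto simp: disjoint_family_on_def)
        moreover have "\<mu> i \<noteq> \<mu> k" using inj_on_eq_iff[OF inj ik(1,2)] ik(3) by blast
        ultimately show "X' i \<inter> X' k = {}" using \<mu>X[of i k] \<mu>X[of k i] ik by (auto simp: X'_def)
      qed
      have "(\<Union>i\<in>?F. X' i) = (\<Union>i\<in>?F. X i) \<union> \<mu> ` S" using S by (auto simp: X'_def)
      then show "(\<Union>i\<in>?F. X' i) = R" using X(2) SR by (auto simp: R'_def)
      show "nonwasteful m a X'"
        using nw Spos unfolding nonwasteful_def X'_def by auto
      show "\<forall>i\<in>?F. 0 \<le> x' i" using x p by (simp add: x'_def)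
      show "\<forall>j\<in>R. 0 \<le> y' j"
      proof
        fix j assume "j \<in> R"
        show "0 \<le> y' j"
        proof (cases "j \<in> R'")
          case True
          then show ?thesis using y by (simp add: y'_def)
        next
          case False
          then obtain k where "k \<in> S" "j = \<mu> k" using \<open>j \<in> R\<close> by (auto simp: R'_def)
          then show ?thesis using q[of k] S by (auto simp: y'\<mu>)
        qed
      qed
      show "local_financing m a X' x' y'"
        unfolding local_financing_def
      proof
        fix i assume i: "i \<in> ?F"
        have "x i + (\<Sum>j\<in>X i. y' j) = firm_value a i (X i)"
          using lf i y'R[OF XR(1)[OF i]] by (simp add: local_financing_def)
        \<comment> \<open>A firm that hires nobody in this round has \<open>c i i = 0\<close>, so it
          claims no profit without income.\<close>
        moreover have "p i = 0" if "i \<notin> S"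
          using pq[OF i] p[OF i] q[OF i] cdiag[OF i] not_S[OF i that] by simp
        ultimately show "x' i + (\<Sum>j\<in>X' i. y' j) = firm_value a i (X' i)"
          using \<mu>X[of i i] i pq[OF i] cdiag[OF i] XR(2)[OF i] fv_own[OF i] y'\<mu>[of i]
          by (cases "i \<in> S") (auto simp: x'_def X'_def not_S)
      qed
      show "EF1 m a X'"
        unfolding EF1_def
      proof (intro ballI impI)
        fix i k assume i: "i \<in> ?F" and k: "k \<in> ?F" and ne: "X' k \<noteq> {}"
        show "\<exists>g\<in>X' k. firm_value a i (X' i) \<ge> firm_value a i (X' k - {g})"
        proof (cases "k \<in> S")
          case False
          with ne have "X k \<noteq> {}" by (simp add: X'_def)
          then obtain g where g: "g \<in> X k" "firm_value a i (X i) \<ge> firm_value a i (X k - {g})"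
            using ef i k unfolding EF1_def by blast
          then show ?thesis using fv_own[OF i] b0[OF i, of "\<mu> i"] False by (auto simp: X'_def intro!: bexI[of _ g])
        next
          case True
          \<comment> \<open>The worker removed for EF1 is the new one, \<open>\<mu> k\<close>. The
            worker \<open>g\<close> formerly removed from \<open>X k\<close> was left over in this
            round, so by \<open>best\<close> the gain of \<open>i\<close> in this round makes up for
            him.\<close>
          have "firm_value a i (X k) \<le> firm_value a i (X i) + b i (\<mu> i)"
          proof (cases "X k = {}")
            case True
            have "0 \<le> firm_value a i (X i)"
              unfolding firm_value_def using nonneg i XR(1)[OF i] R'R(1) by (intro sum_nonneg) auto
            then show ?thesis using True b0[OF i, of "\<mu> i"] by (simp add: firm_value_def)
          next
            case False
            then obtain g where g: "g \<in> X k" "firm_value a i (X i) \<ge> firm_value a i (X k - {g})"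
              using ef i k unfolding EF1_def by blast
            have "firm_value a i (X k) = a i g + firm_value a i (X k - {g})"
              unfolding firm_value_def by (rule sum.remove[OF XR(2)[OF k] g(1)])
            then show ?thesis using g best[OF i, of g] XR(1)[OF k] by auto
          qed
          moreover have "X' k - {\<mu> k} = X k" using True \<mu>X[OF True k] by (simp add: X'_def)
          moreover have "\<mu> k \<in> X' k" using True by (simp add: X'_def)
          ultimately show ?thesis using fv_own[OF i] by (intro bexI[of _ "\<mu> k"]) auto
        qed
      qed
      show "\<forall>i\<in>?F. \<forall>T\<subseteq>R. firm_value a i T \<le> ?D * (x' i + (\<Sum>j\<in>T. y' j))"
      proof (intro ballI allI impI)
        fix i T assume i: "i \<in> ?F" and T: "T \<subseteq> R"
        \<comment> \<open>\<open>K\<close> lists, by partner, the workers of \<open>T\<close> hired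
          in this round; the others lie in \<open>R'\<close> and are covered by the induction
          hypothesis.\<close>
        define K where "K = {k\<in>S. \<mu> k \<in> T}"
        have K: "K \<subseteq> S" "K \<subseteq> ?F" using S by (auto simp: K_def)
        have T_eq: "T = (T \<inter> R') \<union> \<mu> ` K" using T by (auto simp: K_def R'_def)
        have split: "(\<Sum>j\<in>T. f j) = (\<Sum>j\<in>T \<inter> R'. f j) + (\<Sum>k\<in>K. f (\<mu> k))" for f :: "nat \<Rightarrow> real"
        proof -
          have "(\<Sum>j\<in>T. f j) = (\<Sum>j\<in>T \<inter> R'. f j) + (\<Sum>j\<in>\<mu> ` K. f j)"
            using R'R(2) K(1) S(2) by (subst T_eq, intro sum.union_disjoint) (auto simp: R'_def intro: finite_subset)
          also have "(\<Sum>j\<in>\<mu> ` K. f j) = (\<Sum>k\<in>K. f (\<mu> k))"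
            using inj_on_subset[OF injS K(1)] by (simp add: sum.reindex)
          finally show ?thesis .
        qed
        have "(\<Sum>k\<in>K. a i (\<mu> k)) = (\<Sum>k\<in>K. c i k)"
          using K(1) SR by (intro sum.cong) (auto simp: c_def b_def)
        moreover have "(\<Sum>k\<in>K. y' (\<mu> k)) = (\<Sum>k\<in>K. q k)"
          using K(1) y'\<mu> by (intro sum.cong) auto
        ultimately show "firm_value a i T \<le> ?D * (x' i + (\<Sum>j\<in>T. y' j))"
          using core[OF i, of "T \<inter> R'"] round[OF i K(2)] split[of "a i"] split[of y'] y'R[of "T \<inter> R'"]
          by (simp add: firm_value_def x'_def distrib_left)
      qed
    qed
  qed
qed

section \<open>The frontier\<close>

text \<open>By additivity single-firm coalitions suffice: give each worker of \<open>T\<close> to a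
  firm of \<open>I\<close> that values him most and add the inequalities of these firms.\<close>

lemma core_ineqs_firmwise:
  assumes firm: "\<And>i T. i \<in> {1..m} \<Longrightarrow> T \<subseteq> {1..n} \<Longrightarrow> \<alpha> * firm_value a i T \<le> x i + (\<Sum>j\<in>T. y j)"
  shows "core_ineqs m n a \<alpha> x y"
  unfolding core_ineqs_def
proof (intro allI impI)
  fix I T assume "I \<noteq> {} \<and> I \<subseteq> {1..m} \<and> T \<subseteq> {1..n}"
  then have I: "I \<noteq> {}" "I \<subseteq> {1..m}" and T: "T \<subseteq> {1..n}" by auto
  have fin: "finite I" "finite T" using I T by (auto intro: finite_subset)
  have "\<exists>i\<in>I. a i j = Max ((\<lambda>i. a i j) ` I)" for j
  proof -
    have "Max ((\<lambda>i. a i j) ` I) \<in> (\<lambda>i. a i j) ` I" using I fin by (intro Max_in) auto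
    then show ?thesis by auto
  qed
  then obtain f where f: "\<And>j. f j \<in> I" "\<And>j. a (f j) j = Max ((\<lambda>i. a i j) ` I)" by metis
  have group: "(\<Sum>i\<in>I. \<Sum>j\<in>{j\<in>T. f j = i}. h j) = (\<Sum>j\<in>T. h j)" for h :: "nat \<Rightarrow> real"
    using fin f by (intro sum.group) auto
  have "\<alpha> * (\<Sum>j\<in>T. Max ((\<lambda>i. a i j) ` I)) = (\<Sum>i\<in>I. \<alpha> * (\<Sum>j\<in>{j\<in>T. f j = i}. a (f j) j))"
    by (simp only: f(2)[symmetric] group sum_distrib_left[symmetric])
  also have "\<dots> = (\<Sum>i\<in>I. \<alpha> * firm_value a i {j\<in>T. f j = i})"
  proof -
    have "(\<Sum>j\<in>{j\<in>T. f j = i}. a (f j) j) = firm_value a i {j\<in>T. f j = i}" for i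
      unfolding firm_value_def by (intro sum.cong) auto
    then show ?thesis by simp
  qed
  also have "\<dots> \<le> (\<Sum>i\<in>I. x i + (\<Sum>j\<in>{j\<in>T. f j = i}. y j))"
    using I T by (intro sum_mono firm) auto
  also have "\<dots> = (\<Sum>i\<in>I. x i) + (\<Sum>j\<in>T. y j)" by (simp add: sum.distrib group)
  finally show "(\<Sum>i\<in>I. x i) + (\<Sum>j\<in>T. y j) \<ge> \<alpha> * (\<Sum>j\<in>T. Max ((\<lambda>i. a i j) ` I))" .
qed

lemma core_alpha_ge:
  assumes "0 \<le> \<alpha>" "in_core m n a \<alpha> X x y"
  shows "ereal \<alpha> \<le> core_alpha m n a X"
  unfolding core_alpha_def using assms by (intro Sup_upper) blast

lemma market_delta_ratio:
  assumes a: "market m n a" and \<delta>: "0 \<le> \<delta>" "\<delta> \<le> market_delta m n a"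
    and i: "i \<in> {1..m}" and k: "k \<in> {1..m}" and j: "j \<in> {1..n}" and pos: "0 < a i j"
  shows "\<delta> * a k j \<le> a i j"
proof -
  let ?S = "{a i j / max_value m a j | i j. i \<in> {1..m} \<and> j \<in> {1..n} \<and> 0 < a i j}"
  have "?S \<subseteq> (\<lambda>(i, j). a i j / max_value m a j) ` ({1..m} \<times> {1..n})" by auto
  then have "finite ?S" by (rule finite_subset) auto
  moreover have "a i j / max_value m a j \<in> ?S" using i j pos by blast
  ultimately have "Min ?S \<le> a i j / max_value m a j" by (rule Min_le)
  moreover have "market_delta m n a = Min ?S"
    unfolding market_delta_def using i j pos by (subst if_P) blast+
  ultimately have d: "\<delta> \<le> a i j / max_value m a j" using \<delta> by simp
  have M: "a l j \<le> max_value m a j" if "l \<in> {1..m}" for l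
    unfolding max_value_def using that by (intro Max_ge) auto
  have "\<delta> * a k j \<le> \<delta> * max_value m a j" using M[OF k] \<delta>(1) by (rule mult_left_mono)
  also have "\<dots> \<le> a i j" using d M[OF i] pos by (simp add: pos_le_divide_eq)
  finally show ?thesis .
qed

lemma core_alpha_ge_ratio:
  assumes a: "market m n a" and \<delta>: "0 \<le> \<delta>" and X: "complete_matching m n X" "nonwasteful m a X"
    and ratio: "\<And>i k j. i \<in> {1..m} \<Longrightarrow> k \<in> {1..m} \<Longrightarrow> j \<in> {1..n} \<Longrightarrow> 0 < a i j \<Longrightarrow> \<delta> * a k j \<le> a i j"
  shows "ereal \<delta> \<le> core_alpha m n a X"
proof -
  have XW: "(\<Union>i\<in>{1..m}. X i) = {1..n}" and disj: "disjoint_family_on X {1..m}"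
    using X(1) by (auto simp: complete_matching_def)
  then have "\<exists>i. i \<in> {1..m} \<and> j \<in> X i" if "j \<in> {1..n}" for j using that by blast
  then obtain f where f: "\<And>j. j \<in> {1..n} \<Longrightarrow> f j \<in> {1..m} \<and> j \<in> X (f j)" by metis
  have f_eq: "f j = i" if "i \<in> {1..m}" "j \<in> X i" for i j
  proof -
    have "j \<in> {1..n}" using that XW by blast
    then have "f j \<in> {1..m}" "j \<in> X (f j)" using f by auto
    then show ?thesis using that disj unfolding disjoint_family_on_def by blast
  qed
  let ?y = "\<lambda>j. a (f j) j"
  \<comment> \<open>If the employer values \<open>j\<close> at 0, then \<open>nonwasteful\<close>
    makes \<open>j\<close> worthless to every firm; otherwise \<open>ratio\<close> applies.\<close>
  have y: "\<delta> * a k j \<le> ?y j" if k: "k \<in> {1..m}" and j: "j \<in> {1..n}" for k j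
    using X(2) f[OF j] ratio[of "f j" k j] k j unfolding nonwasteful_def by fastforce
  have "in_core m n a \<delta> X (\<lambda>_. 0) ?y"
    unfolding in_core_def
  proof (intro conjI)
    show "\<forall>j\<in>{1..n}. 0 \<le> ?y j" using a f by (auto simp: market_def)
    show "local_financing m a X (\<lambda>_. 0) ?y"
      unfolding local_financing_def firm_value_def by (auto simp: f_eq intro!: sum.cong)
    show "core_ineqs m n a \<delta> (\<lambda>_. 0) ?y"
    proof (rule core_ineqs_firmwise)
      fix i T assume "i \<in> {1..m}" "T \<subseteq> {1..n}"
      then show "\<delta> * firm_value a i T \<le> 0 + (\<Sum>j\<in>T. ?y j)"
        using y unfolding firm_value_def by (auto simp: sum_distrib_left intro!: sum_mono)
    qed
  qed simp
  then show ?thesis by (rule core_alpha_ge[OF \<delta>])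
qed

text \<open>For \<open>(real m - 1) * \<delta> \<le> 1\<close> one matching attains both terms of
  the maximum. Beyond that threshold \<open>\<delta>\<close> is the larger term, and nonwastefulness
  alone yields it.\<close>

lemma EF1_matching_lower:
  assumes m: "1 \<le> m" and a: "market m n a" and \<delta>: "0 \<le> \<delta>" "\<delta> \<le> 1" "\<delta> \<le> market_delta m n a"
  shows "\<exists>X. complete_matching m n X \<and> EF1 m a X \<and> ereal (frontier_lower m \<delta>) \<le> core_alpha m n a X"
proof -
  let ?D = "real m - (real m - 1) * \<delta>"
  note ratio = market_delta_ratio[OF a \<delta>(1,3)]
  have nonneg: "\<forall>i\<in>{1..m}. \<forall>j\<in>{1..n}. 0 \<le> a i j" using a by (simp add: market_def)
  have D1: "1 \<le> ?D"
  proof -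
    have "?D - 1 = (real m - 1) * (1 - \<delta>)" by (simp add: algebra_simps)
    also have "\<dots> \<ge> 0" using m \<delta> by simp
    finally show ?thesis by simp
  qed
  show ?thesis
  proof (cases "(real m - 1) * \<delta> \<le> 1")
    case True
    have ratio': "\<forall>i\<in>{1..m}. \<forall>k\<in>{1..m}. \<forall>j\<in>{1..n}. 0 < a i j \<longrightarrow> \<delta> * a k j \<le> a i j"
      using ratio by blast
    obtain X x y where X: "disjoint_family_on X {1..m}" "(\<Union>i\<in>{1..m}. X i) = {1..n}" "EF1 m a X" "nonwasteful m a X"
      and x: "\<forall>i\<in>{1..m}. 0 \<le> x i" and y: "\<forall>j\<in>{1..n}. 0 \<le> y j" and lf: "local_financing m a X x y"
      and core: "\<forall>i\<in>{1..m}. \<forall>T\<subseteq>{1..n}. firm_value a i T \<le> ?D * (x i + (\<Sum>j\<in>T. y j))"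
      using round_matching[OF m finite_atLeastAtMost nonneg \<delta>(1,2) True ratio'] by (elim exE conjE) (rule that)
    have "core_ineqs m n a (1 / ?D) x y"
      using core D1 by (intro core_ineqs_firmwise) (auto simp: divide_le_eq mult.commute)
    then have "ereal (1 / ?D) \<le> core_alpha m n a X"
      using x y lf D1 by (intro core_alpha_ge) (auto simp: in_core_def)
    moreover have "ereal \<delta> \<le> core_alpha m n a X"
      using X by (intro core_alpha_ge_ratio[OF a \<delta>(1) _ _ ratio]) (auto simp: complete_matching_def)
    ultimately have "ereal (frontier_lower m \<delta>) \<le> core_alpha m n a X"
      by (simp add: frontier_lower_def max_def)
    then show ?thesis using X by (auto simp: complete_matching_def)
  next
    case False
    \<comment> \<open>Only the matching is wanted here, so the rounds are run with 0 for
      \<open>\<delta>\<close>, where the threshold condition holds trivially.\<close>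
    have ratio0: "\<forall>i\<in>{1..m}. \<forall>k\<in>{1..m}. \<forall>j\<in>{1..n}. 0 < a i j \<longrightarrow> 0 * a k j \<le> a i j"
      by simp
    obtain X where X: "disjoint_family_on X {1..m}" "(\<Union>i\<in>{1..m}. X i) = {1..n}" "EF1 m a X" "nonwasteful m a X"
      using round_matching[OF m finite_atLeastAtMost nonneg _ _ _ ratio0] by auto
    have "ereal \<delta> \<le> core_alpha m n a X"
      using X by (intro core_alpha_ge_ratio[OF a \<delta>(1) _ _ ratio]) (auto simp: complete_matching_def)
    moreover have "1 \<le> \<delta> * ?D"
    proof -
      have "\<delta> * ?D - 1 = (1 - \<delta>) * ((real m - 1) * \<delta> - 1)" by (simp add: algebra_simps)
      also have "\<dots> \<ge> 0" using False \<delta> by simp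
      finally show ?thesis by simp
    qed
    then have "1 / ?D \<le> \<delta>" using D1 by (simp add: divide_le_eq)
    ultimately show ?thesis using X by (auto simp: complete_matching_def frontier_lower_def max_def)
  qed
qed

lemma EF1_frontier_ge:
  assumes "1 \<le> m" "0 \<le> \<delta>" "\<delta> \<le> 1"
  shows "ereal (frontier_lower m \<delta>) \<le> EF1_frontier m \<delta>"
  unfolding EF1_frontier_def
proof (rule INF_greatest)
  fix na assume "na \<in> {(n, a). market m n a \<and> \<delta> \<le> market_delta m n a}"
  then obtain n a where na: "na = (n, a)" "market m n a" "\<delta> \<le> market_delta m n a" by auto
  then obtain X where "complete_matching m n X" "EF1 m a X" "ereal (frontier_lower m \<delta>) \<le> core_alpha m n a X"
    using EF1_matching_lower assms by blast
  then show "ereal (frontier_lower m \<delta>) \<le> (case na of (n, a) \<Rightarrow>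
      SUP X\<in>{X. complete_matching m n X \<and> EF1 m a X}. core_alpha m n a X)"
    unfolding na by (auto intro: SUP_upper2)
qed

text \<open>The value \<open>\<epsilon>\<close> must be positive for \<open>EF1\<close> to bind, so \<open>\<delta> = 0\<close> is only approached.\<close>

lemma EF1_frontier_le_pos:
  assumes m: "1 \<le> m" and \<epsilon>: "0 < \<epsilon>" "\<epsilon> \<le> 1" "\<delta> \<le> \<epsilon>"
  shows "EF1_frontier m \<delta> \<le> ereal (frontier_upper m \<epsilon>)"
proof -
  define a :: "nat \<Rightarrow> nat \<Rightarrow> real" where "a i j = (if i = 1 then 1 else \<epsilon>)" for i j
  have apos: "0 < a i j" for i j using \<epsilon> by (simp add: a_def)
  have mx: "Max ((\<lambda>i. a i j) ` {1..m}) = 1" for j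
    using m \<epsilon> by (intro Max_eqI) (auto simp: a_def image_iff intro!: bexI[of _ 1])
  have "market m m a" using \<epsilon> by (simp add: market_def a_def)
  moreover have "\<delta> \<le> market_delta m m a"
  proof -
    let ?S = "{a i j / max_value m a j | i j. i \<in> {1..m} \<and> j \<in> {1..m} \<and> 0 < a i j}"
    have ex: "\<exists>i\<in>{1..m}. \<exists>j\<in>{1..m}. 0 < a i j" using m apos by auto
    have "?S \<subseteq> (\<lambda>(i, j). a i j / max_value m a j) ` ({1..m} \<times> {1..m})" by auto
    then have "finite ?S" by (rule finite_subset) auto
    moreover have "?S \<noteq> {}" using ex by blast
    ultimately have "Min ?S \<in> ?S" by (rule Min_in)
    then obtain i j where "Min ?S = a i j / max_value m a j" by blast
    moreover have "max_value m a j = 1" by (simp only: max_value_def mx)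
    ultimately have "\<epsilon> \<le> Min ?S" using \<epsilon> by (simp only: div_by_1) (simp add: a_def)
    then show ?thesis using ex \<epsilon> unfolding market_delta_def by simp
  qed
  ultimately have mem: "(m, a) \<in> {(n, a). market m n a \<and> \<delta> \<le> market_delta m n a}" by simp
  have "core_alpha m m a X \<le> ereal (frontier_upper m \<epsilon>)"
    if X: "complete_matching m m X" "EF1 m a X" for X
  proof -
    have XW: "(\<Union>i\<in>{1..m}. X i) = {1..m}" and disj: "disjoint_family_on X {1..m}"
      using X(1) by (auto simp: complete_matching_def)
    have sub: "X i \<subseteq> {1..m}" if "i \<in> {1..m}" for i using that XW by blast
    have fin: "finite (X i)" if "i \<in> {1..m}" for i using sub[OF that] by (rule finite_subset) simp
    have split: "(\<Sum>i\<in>{1..m}. \<Sum>j\<in>X i. f j) = (\<Sum>j\<in>{1..m}. f j)" for f :: "nat \<Rightarrow> 'b::comm_monoid_add"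
      using sum.UNION_disjoint_family[of "{1..m}" X f] fin disj XW by simp
    have card_sum: "(\<Sum>i\<in>{1..m}. card (X i)) = m" using split[of "\<lambda>_. 1::nat"] by simp
    have one: "1 \<in> {1..m}" using m by simp
    have card1: "card (X 1) \<le> 1"
    proof (rule ccontr)
      assume c: "\<not> card (X 1) \<le> 1"
      \<comment> \<open>Pigeonhole with as many workers as firms: a second worker at firm 1 leaves
        some firm empty-handed, and that firm envies firm 1 even after one removal because
        \<open>\<epsilon> > 0\<close>.\<close>
      have "\<exists>k\<in>{1..m}. X k = {}"
      proof (rule ccontr)
        assume "\<not> (\<exists>k\<in>{1..m}. X k = {})"
        then have "1 \<le> card (X k)" if "k \<in> {1..m}" for k
          using that fin by (simp add: Suc_leI card_gt_0_iff)
        then have "(\<Sum>i\<in>{1..m}. 1) < (\<Sum>i\<in>{1..m}. card (X i))"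
          using c one by (intro sum_strict_mono_ex1) (auto simp: not_le)
        then show False using card_sum by simp
      qed
      then obtain k where k: "k \<in> {1..m}" "X k = {}" by blast
      have "X 1 \<noteq> {}" using c by auto
      then obtain g where g: "g \<in> X 1" "firm_value a k (X k) \<ge> firm_value a k (X 1 - {g})"
        using X(2) k(1) one unfolding EF1_def by blast
      have "X 1 - {g} \<noteq> {}"
      proof
        assume "X 1 - {g} = {}"
        then have "X 1 \<subseteq> {g}" by blast
        then show False using c card_mono[of "{g}" "X 1"] by simp
      qed
      then have "0 < firm_value a k (X 1 - {g})"
        unfolding firm_value_def using fin[OF one] apos by (intro sum_pos) auto
      then show False using g k by (simp add: firm_value_def)
    qed
    \<comment> \<open>Every worker creates \<open>\<epsilon>\<close>, with a bonus
      \<open>1 - \<epsilon>\<close> at firm 1.\<close>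
    have "(\<Sum>i\<in>{1..m}. firm_value a i (X i)) = (\<Sum>i\<in>{1..m}. \<epsilon> * real (card (X i)) + (if i = 1 then (1 - \<epsilon>) * real (card (X 1)) else 0))"
      by (intro sum.cong) (auto simp: firm_value_def a_def algebra_simps)
    also have "\<dots> = \<epsilon> * real m + (1 - \<epsilon>) * real (card (X 1))"
      using one card_sum by (simp add: sum.distrib sum_distrib_left[symmetric] of_nat_sum[symmetric])
    also have "\<dots> \<le> \<epsilon> * real m + (1 - \<epsilon>) * 1"
      using card1 \<epsilon> by (intro add_left_mono mult_left_mono) auto
    finally have welfare: "(\<Sum>i\<in>{1..m}. firm_value a i (X i)) \<le> \<epsilon> * real m + (1 - \<epsilon>)" by simp
    have "\<alpha> \<le> frontier_upper m \<epsilon>" if "in_core m m a \<alpha> X x y" for \<alpha> x y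
    proof -
      have lf: "local_financing m a X x y" and ci: "core_ineqs m m a \<alpha> x y"
        using that by (auto simp: in_core_def)
      \<comment> \<open>The coalition of all firms and workers demands
        \<open>\<alpha> * real m\<close>, and local financing turns the total payoff into the
        welfare just bounded.\<close>
      have "\<alpha> * real m \<le> (\<Sum>i\<in>{1..m}. x i) + (\<Sum>j\<in>{1..m}. y j)"
        using ci[unfolded core_ineqs_def, rule_format, of "{1..m}" "{1..m}"] m unfolding mx by simp
      also have "\<dots> = (\<Sum>i\<in>{1..m}. x i + (\<Sum>j\<in>X i. y j))" by (simp only: sum.distrib split)
      also have "\<dots> = (\<Sum>i\<in>{1..m}. firm_value a i (X i))"
        using lf by (intro sum.cong) (auto simp: local_financing_def)
      also note welfare
      finally have "\<alpha> * real m \<le> frontier_upper m \<epsilon> * real m"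
        using m by (simp add: frontier_upper_def distrib_right)
      then show ?thesis using m by simp
    qed
    then show ?thesis unfolding core_alpha_def by (auto intro!: Sup_least)
  qed
  then have "(SUP X\<in>{X. complete_matching m m X \<and> EF1 m a X}. core_alpha m m a X) \<le> ereal (frontier_upper m \<epsilon>)"
    by (intro SUP_least) auto
  then show ?thesis unfolding EF1_frontier_def by (intro INF_lower2[OF mem]) simp
qed

text \<open>For \<open>\<delta> = 0\<close> the bound holds with every small
  \<open>\<epsilon> > 0\<close> and passes to the limit, since \<open>frontier_upper m\<close> is
  continuous at 0.\<close>

lemma EF1_frontier_le:
  assumes m: "1 \<le> m" and \<delta>: "0 \<le> \<delta>" "\<delta> \<le> 1"
  shows "EF1_frontier m \<delta> \<le> ereal (frontier_upper m \<delta>)"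
proof (cases "\<delta> = 0")
  case False
  then show ?thesis using assms by (intro EF1_frontier_le_pos) auto
next
  case True
  have "(frontier_upper m \<longlongrightarrow> frontier_upper m 0) (at_right 0)"
    unfolding frontier_upper_def using m by (intro tendsto_intros) auto
  then have "((\<lambda>\<epsilon>. ereal (frontier_upper m \<epsilon>)) \<longlongrightarrow> ereal (frontier_upper m 0)) (at_right 0)"
    by (rule tendsto_ereal)
  moreover have "eventually (\<lambda>\<epsilon>. EF1_frontier m 0 \<le> ereal (frontier_upper m \<epsilon>)) (at_right (0::real))"
    using m by (auto simp: eventually_at_right_field intro!: exI[of _ 1] EF1_frontier_le_pos)
  ultimately show ?thesis
    unfolding True by (intro tendsto_lowerbound[of _ _ "at_right (0::real)"]) auto
qed

lemma frontier_upper_tendsto: "(\<lambda>m. frontier_upper m \<delta>) \<longlonglongrightarrow> \<delta>"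
proof -
  have "(\<lambda>m. (1 - \<delta>) / real m) \<longlonglongrightarrow> 0" by (rule lim_const_over_n)
  then show ?thesis unfolding frontier_upper_def using tendsto_add[OF tendsto_const[of \<delta>]] by fastforce
qed

theorem theorem8:
  shows "(\<forall>m::nat. \<forall>\<delta>::real. 2 \<le> m \<longrightarrow> 0 \<le> \<delta> \<longrightarrow> \<delta> \<le> 1 \<longrightarrow>
            ereal (frontier_lower m \<delta>) \<le> EF1_frontier m \<delta> \<and>
            EF1_frontier m \<delta> \<le> ereal (frontier_upper m \<delta>)) \<and>
         (\<forall>m::nat. 2 \<le> m \<longrightarrow> EF1_frontier m 0 = ereal (1 / real m)) \<and>
         (\<forall>\<delta>::real. 0 \<le> \<delta> \<longrightarrow> \<delta> \<le> 1 \<longrightarrow>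
            (\<lambda>m. EF1_frontier m \<delta>) \<longlonglongrightarrow> ereal \<delta>)"
proof (intro conjI allI impI)
  fix m :: nat and \<delta> :: real
  assume "2 \<le> m" and \<delta>: "0 \<le> \<delta>" "\<delta> \<le> 1"
  then show "ereal (frontier_lower m \<delta>) \<le> EF1_frontier m \<delta>" "EF1_frontier m \<delta> \<le> ereal (frontier_upper m \<delta>)"
    by (auto intro: EF1_frontier_ge EF1_frontier_le)
next
  fix m :: nat assume "2 \<le> m"
  then show "EF1_frontier m 0 = ereal (1 / real m)"
    \<comment> \<open>At \<open>\<delta> = 0\<close> both bounds equal
      \<open>1 / real m\<close>.\<close>
    using EF1_frontier_ge[of m 0] EF1_frontier_le[of m 0]
    by (simp add: frontier_lower_def frontier_upper_def max_def split: if_splits)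
next
  fix \<delta> :: real assume \<delta>: "0 \<le> \<delta>" "\<delta> \<le> 1"
  show "(\<lambda>m. EF1_frontier m \<delta>) \<longlonglongrightarrow> ereal \<delta>"
  \<comment> \<open>The term \<open>\<delta>\<close> of the lower bound is enough, because the upper
    bound exceeds it only by \<open>(1 - \<delta>) / real m\<close>.\<close>
  proof (rule tendsto_sandwich)
    show "eventually (\<lambda>m. ereal \<delta> \<le> EF1_frontier m \<delta>) sequentially"
    proof (rule eventually_sequentiallyI)
      fix m :: nat assume "1 \<le> m"
      have "ereal \<delta> \<le> ereal (frontier_lower m \<delta>)" by (simp add: frontier_lower_def)
      also have "\<dots> \<le> EF1_frontier m \<delta>" using \<open>1 \<le> m\<close> \<delta> by (rule EF1_frontier_ge)
      finally show "ereal \<delta> \<le> EF1_frontier m \<delta>" .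
    qed
    show "eventually (\<lambda>m. EF1_frontier m \<delta> \<le> ereal (frontier_upper m \<delta>)) sequentially"
      using \<delta> by (intro eventually_sequentiallyI EF1_frontier_le)
    show "(\<lambda>m. ereal (frontier_upper m \<delta>)) \<longlonglongrightarrow> ereal \<delta>"
      by (intro tendsto_ereal frontier_upper_tendsto)
  qed simp
qed

end
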